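(* Let $p:\mathbb R\to[0,\infty)$ be the density of a probability distribution with cumulative distribution function $F(x)=\int_{-\infty}^x p(y)\,dy$, let $\alpha>0$, $\alpha\ne1$, and assume $\int_{\mathbb R}p^\alpha(x)\,dx<\infty$. For a sequence of partitions $\pi_N=\{x_k^N: k=0,\dots,k_N\}$, $N\ge1$, with $x_0^N<x_1^N<\dots<x_{k_N}^N$, put $\Delta_k^N=x_k^N-x_{k-1}^N$, $\Delta F_k^N=F(x_k^N)-F(x_{k-1}^N)$, and $$\widetilde{\mathcal H}_{R,\alpha}^N=\frac{1}{1-\alpha}\log\left(\sum_{k=1}^{k_N}\left(\Delta F_k^N\right)^\alpha\left(\Delta_k^N\right)^{1-\alpha}\right).$$ (i) Let $\alpha>1$ and let $p$ be continuous on $\mathbb R$. Then for every sequence of partitions $\pi_N$ such that $x_0^N\to-\infty$, $x_{k_N}^N\to+\infty$ and $\max_{1\le k\le k_N}\Delta_k^N\to0$ as $N\to\infty$, $$\widetilde{\mathcal H}_{R,\alpha}^N\to\frac{1}{1-\alpha}\log\left(\int_{\mathbb R}p^\alpha(x)\,dx\right)\quad\text{as }N\to\infty.$$ (ii) Let $0<\alpha<1$ and consider only the uniform partitions $\pi_N=\{\frac kN: k=-N^2,\dots,N^2\}$. Assume that $p$ is continuous on $\mathbb R$ and that there exists $z>0$ such that $p$ increases on $(-\infty,-z]$ and decreases on $[z,\infty)$. Then $$\widetilde{\mathcal H}_{R,\alpha}^N\to\frac{1}{1-\alpha}\log\left(\int_{\mathbb R}p^\alpha(x)\,dx\right)\quad\text{as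 }N\to\infty.$$
   Context: $\log$ is the natural logarithm. The limit $\mathcal H_{R,\alpha}(\{p(x),x\in\mathbb R\})=\frac{1}{1-\alpha}\log\left(\int_{\mathbb R}p^\alpha(x)\,dx\right)$ is the Rényi entropy of index $\alpha$ of the density $p$. *)

theory Defs
  imports "HOL-Analysis.Analysis"
begin

definition prob_density :: "(real \<Rightarrow> real) \<Rightarrow> bool" where
  "prob_density p \<longleftrightarrow>
     (\<forall>x. 0 \<le> p x) \<and> integrable lborel p \<and> (LINT x|lborel. p x) = 1"

definition distr_fun :: "(real \<Rightarrow> real) \<Rightarrow> real \<Rightarrow> real" where
  "distr_fun p x = (LINT y:{..x}|lborel. p y)"

definition renyi_entropy :: "real \<Rightarrow> (real \<Rightarrow> real) \<Rightarrow> real" where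
  "renyi_entropy \<alpha> p = 1 / (1 - \<alpha>) * ln (LINT x|lborel. p x powr \<alpha>)"

text \<open>A partition with points \<open>x 0 < \<dots> < x n\<close> is given by the pair of \<open>n\<close> and \<open>x\<close>;
  the values of \<open>x\<close> beyond \<open>n\<close> are irrelevant.\<close>

definition is_partition :: "nat \<Rightarrow> (nat \<Rightarrow> real) \<Rightarrow> bool" where
  "is_partition n x \<longleftrightarrow> 0 < n \<and> (\<forall>k\<in>{1..n}. x (k - 1) < x k)"

definition mesh :: "nat \<Rightarrow> (nat \<Rightarrow> real) \<Rightarrow> real" where
  "mesh n x = Max ((\<lambda>k. x k - x (k - 1)) ` {1..n})"

definition discretized_renyi_entropy ::
    "real \<Rightarrow> (real \<Rightarrow> real) \<Rightarrow> nat \<Rightarrow> (nat \<Rightarrow> real) \<Rightarrow> real" where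
  "discretized_renyi_entropy \<alpha> p n x =
     1 / (1 - \<alpha>) *
     ln (\<Sum>k=1..n. (distr_fun p (x k) - distr_fun p (x (k - 1))) powr \<alpha>
                     * (x k - x (k - 1)) powr (1 - \<alpha>))"

text \<open>The points \<open>j / N\<close> for \<open>j = - N\<^sup>2, \<dots>, N\<^sup>2\<close>, renumbered by \<open>k = j + N\<^sup>2 = 0, \<dots>, 2 N\<^sup>2\<close>.\<close>

definition uniform_points :: "nat \<Rightarrow> nat \<Rightarrow> real" where
  "uniform_points N k = (real k - real (N ^ 2)) / real N"

lemma uniform_points_image:
  "uniform_points N ` {0..2 * N ^ 2} = (\<lambda>j. real_of_int j / real N) ` {- int (N ^ 2)..int (N ^ 2)}"
proof -
  have "(\<lambda>k. int k - int m) ` {0..2 * m} = {- int m..int m}" for m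
  proof (intro equalityI subsetI)
    fix j assume "j \<in> {- int m..int m}"
    then have "j = int (nat (j + int m)) - int m" "nat (j + int m) \<in> {0..2 * m}"
      by auto
    then show "j \<in> (\<lambda>k. int k - int m) ` {0..2 * m}"
      by (rule image_eqI)
  qed auto
  moreover have "uniform_points N = (\<lambda>j. real_of_int j / real N) \<circ> (\<lambda>k. int k - int (N ^ 2))"
    by (simp add: fun_eq_iff uniform_points_def)
  ultimately show ?thesis
    by (simp only: image_comp [symmetric])
qed

lemma is_partition_uniform_points:
  "1 \<le> N \<Longrightarrow> is_partition (2 * N ^ 2) (uniform_points N)"
  by (auto simp: is_partition_def uniform_points_def divide_strict_right_mono)

end

theory Submission
  imports Defs
begin

text \<open>
  On a cell \<open>(a, b]\<close> of a partition, \<open>(F b - F a) powr \<alpha> * (b - a) powr (1 - \<alpha>)\<close> equals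
  \<open>m powr \<alpha> * (b - a)\<close>, where \<open>m\<close> is the average of \<open>p\<close> over the cell.  Hence the sum inside
  the logarithm is the integral of the step function \<open>renyi_step\<close> whose value on each cell is the
  \<open>\<alpha>\<close>-th power of that average.  Continuity of \<open>p\<close> makes these step functions converge
  pointwise to \<open>p powr \<alpha>\<close> (\<open>renyi_step_tendsto\<close>).  The integral of \<open>p powr \<alpha>\<close> is positive,
  so \<open>ln\<close> is continuous there, and all that remains is to pass from pointwise convergence to
  convergence of the integrals.

  For \<open>\<alpha> > 1\<close>, the function \<open>u powr \<alpha>\<close> is convex, and Jensen's inequality on each cell bounds the
  integral of the step function by that of \<open>p powr \<alpha>\<close>.  In the other direction, the minimum
  of the step function and \<open>p powr \<alpha>\<close> is dominated by \<open>p powr \<alpha>\<close>, so its integral converges to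
  that of \<open>p powr \<alpha>\<close>.  The integral of the step function is squeezed between the two.

  For \<open>\<alpha> < 1\<close>, Jensen's inequality points the other way and mass could escape to infinity; monotone
  tails exclude this.  As soon as the cells are shorter than \<open>1\<close>, the average around a point \<open>t\<close> far
  to the right is at most \<open>p (t - 1)\<close>, and around a point far to the left at most \<open>p (t + 1)\<close>.
  With a constant bound in the middle this gives an integrable function that dominates all
  step functions.
\<close>

section \<open>Averages of the density over a cell\<close>

lemma integrable_indicator_Ioc:
  "integrable lborel (indicator {a<..b::real} :: real \<Rightarrow> real)"
  by (cases "a \<le> b") (auto intro!: integrable_real_indicator)

lemma distr_fun_diff:
  assumes "integrable lborel p" "a \<le> b"
  shows "distr_fun p b - distr_fun p a = (LINT y:{a<..b}|lborel. p y)"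
proof -
  have set_int: "set_integrable lborel A p" if "A \<in> sets lborel" for A
    using assms(1) that unfolding set_integrable_def by (intro integrable_mult_indicator)
  have "{..b} = {..a} \<union> {a<..b}"
    using assms(2) by auto
  then have "distr_fun p b = distr_fun p a + (LINT y:{a<..b}|lborel. p y)"
    unfolding distr_fun_def by (simp only:, subst set_integral_Un) (auto intro!: set_int)
  then show ?thesis by simp
qed

definition cell_average :: "(real \<Rightarrow> real) \<Rightarrow> real \<Rightarrow> real \<Rightarrow> real" where
  "cell_average p a b = (distr_fun p b - distr_fun p a) / (b - a)"

lemma cell_average_bounds:
  assumes p: "integrable lborel p" and "a < b"
    and bounds: "\<And>s. a < s \<Longrightarrow> s \<le> b \<Longrightarrow> L \<le> p s \<and> p s \<le> U"
  shows "L \<le> cell_average p a b" and "cell_average p a b \<le> U"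
proof -
  have p_int: "set_integrable lborel {a<..b} p"
    using p unfolding set_integrable_def by (intro integrable_mult_indicator) auto
  have const_int: "set_integrable lborel {a<..b} (\<lambda>_. c)" for c :: real
    unfolding set_integrable_def by (simp add: integrable_indicator_Ioc)
  have const: "(LINT y:{a<..b}|lborel. c) = (b - a) * c" for c :: real
    using \<open>a < b\<close> by (simp add: set_lebesgue_integral_def)
  have "(LINT y:{a<..b}|lborel. L) \<le> (LINT y:{a<..b}|lborel. p y)"
    by (rule set_integral_mono[OF const_int p_int]) (use bounds in auto)
  moreover have "(LINT y:{a<..b}|lborel. p y) \<le> (LINT y:{a<..b}|lborel. U)"
    by (rule set_integral_mono[OF p_int const_int]) (use bounds in auto)
  ultimately show "L \<le> cell_average p a b" and "cell_average p a b \<le> U"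
    using \<open>a < b\<close> unfolding cell_average_def
    by (simp_all add: distr_fun_diff[OF p] const field_simps)
qed

lemma cell_average_nonneg:
  assumes "integrable lborel p" "a < b" "\<And>s. 0 \<le> p s"
  shows "0 \<le> cell_average p a b"
proof -
  have "0 \<le> distr_fun p b - distr_fun p a"
    using assms by (simp add: distr_fun_diff set_lebesgue_integral_def integral_nonneg_AE)
  then show ?thesis
    using assms(2) by (simp add: cell_average_def)
qed

text \<open>
  The value \<open>u = 0\<close> is treated apart because convexity of \<open>powr\<close> is used on the open half-line only,
  and densities may vanish.
\<close>

lemma powr_above_tangent:
  fixes u m :: real
  assumes "1 < \<alpha>" "0 \<le> u" "0 < m"
  shows "m powr \<alpha> + \<alpha> * m powr (\<alpha> - 1) * (u - m) \<le> u powr \<alpha>"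
proof (cases "u = 0")
  case True
  have "m powr (\<alpha> - 1) * m = m powr \<alpha>"
    using \<open>0 < m\<close> by (simp add: powr_diff)
  then have "m powr \<alpha> + \<alpha> * m powr (\<alpha> - 1) * (u - m) = (1 - \<alpha>) * m powr \<alpha>"
    using True by (simp add: algebra_simps)
  also have "\<dots> \<le> 0"
    using assms by (intro mult_nonpos_nonneg) auto
  finally show ?thesis
    using True by simp
next
  case False
  have "(\<alpha> * m powr (\<alpha> - 1)) * (u - m) \<le> u powr \<alpha> - m powr \<alpha>"
  proof (rule convex_on_imp_above_tangent)
    show "convex_on {0<..} (\<lambda>x::real. x powr \<alpha>)"
      using assms by (intro powr_convex) auto
    show "((\<lambda>x. x powr \<alpha>) has_real_derivative \<alpha> * m powr (\<alpha> - 1)) (at m within {0<..})"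
      using assms by (auto intro!: derivative_eq_intros)
    show "connected {0::real<..}" by simp
    show "m \<in> interior {0<..}"
      using assms by (simp add: interior_open)
    show "u \<in> {0<..}" using assms False by simp
  qed
  then show ?thesis by simp
qed

text \<open>
  Jensen's inequality for the uniform distribution on a cell: integrate the tangent of
  \<open>u powr \<alpha>\<close> at the average \<open>m\<close>, evaluated at \<open>u = p y\<close>.  The linear term
  \<open>\<alpha> * m powr (\<alpha> - 1) * (p y - m)\<close> integrates to \<open>0\<close>, so the tangent contributes
  \<open>m powr \<alpha> * (b - a)\<close>.
\<close>

lemma cell_average_powr_le:
  assumes p: "integrable lborel p" and p_nonneg: "\<And>s. 0 \<le> p s"
    and pa: "integrable lborel (\<lambda>s. p s powr \<alpha>)" and "1 < \<alpha>" "a < b"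
  shows "cell_average p a b powr \<alpha> * (b - a) \<le> (LINT y:{a<..b}|lborel. p y powr \<alpha>)"
proof (cases "cell_average p a b = 0")
  case True
  then show ?thesis
    by (simp add: set_lebesgue_integral_def integral_nonneg_AE)
next
  case False
  define m where "m = cell_average p a b"
  define D where "D = \<alpha> * m powr (\<alpha> - 1)"
  have "0 < m"
    using False cell_average_nonneg[OF p \<open>a < b\<close> p_nonneg] by (simp add: m_def)
  have p_int: "integrable lborel (\<lambda>y. indicator {a<..b} y * p y)"
    "integrable lborel (\<lambda>y. indicator {a<..b} y * p y powr \<alpha>)"
    using integrable_mult_indicator[OF _ p, of "{a<..b}"]
      integrable_mult_indicator[OF _ pa, of "{a<..b}"] by auto
  have mass: "(LINT y|lborel. indicator {a<..b} y * p y) = m * (b - a)"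
    using \<open>a < b\<close> distr_fun_diff[OF p, of a b]
    by (simp add: m_def cell_average_def set_lebesgue_integral_def)
  have "(LINT y|lborel. indicator {a<..b} y * (m powr \<alpha> - D * m) + D * (indicator {a<..b} y * p y))
      = (b - a) * (m powr \<alpha> - D * m) + D * (m * (b - a))"
    using \<open>a < b\<close> p_int by (subst Bochner_Integration.integral_add) (auto simp: mass integrable_indicator_Ioc)
  also have "\<dots> = m powr \<alpha> * (b - a)"
    by (simp add: algebra_simps)
  finally have "m powr \<alpha> * (b - a) =
      (LINT y|lborel. indicator {a<..b} y * (m powr \<alpha> - D * m) + D * (indicator {a<..b} y * p y))" ..
  also have "\<dots> \<le> (LINT y|lborel. indicator {a<..b} y * p y powr \<alpha>)"
  proof (rule integral_mono)
    show "integrable lborel (\<lambda>y. indicator {a<..b} y * (m powr \<alpha> - D * m)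
        + D * (indicator {a<..b} y * p y))"
      using p_int by (intro Bochner_Integration.integrable_add) (auto simp: integrable_indicator_Ioc)
    fix y
    show "indicator {a<..b} y * (m powr \<alpha> - D * m) + D * (indicator {a<..b} y * p y)
        \<le> indicator {a<..b} y * p y powr \<alpha>"
      using powr_above_tangent[OF \<open>1 < \<alpha>\<close> p_nonneg[of y] \<open>0 < m\<close>]
      by (auto simp: indicator_def D_def algebra_simps)
  qed (use p_int in auto)
  finally show ?thesis
    by (simp add: m_def set_lebesgue_integral_def)
qed

section \<open>Step functions on a partition\<close>

definition step_fun :: "(nat \<Rightarrow> real) \<Rightarrow> nat \<Rightarrow> (nat \<Rightarrow> real) \<Rightarrow> real \<Rightarrow> real" where
  "step_fun c n x t = (\<Sum>k=1..n. c k * indicator {x (k - 1)<..x k} t)"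

lemma step_fun_eq_coeff:
  assumes "is_partition n x" "k \<in> {1..n}" "t \<in> {x (k - 1)<..x k}"
  shows "step_fun c n x t = c k"
proof -
  have increasing: "x i < x (Suc i)" if "i < n" for i
    using assms(1) that unfolding is_partition_def by (auto dest: bspec[of _ _ "Suc i"])
  have mono: "x i \<le> x j" if "i \<le> j" "j \<le> n" for i j
    using that
  proof (induction rule: dec_induct)
    case (step l)
    then show ?case using increasing[of l] by simp
  qed simp
  have "indicator {x (j - 1)<..x j} t = (if j = k then 1 else (0::real))" if "j \<in> {1..n}" for j
  proof (cases j k rule: linorder_cases)
    case less
    then have "x j \<le> x (k - 1)"
      using assms(2) by (intro mono) auto
    then show ?thesis
      using less assms(3) by (simp add: indicator_def)
  next
    case greater
    then have "x k \<le> x (j - 1)"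
      using that by (intro mono) auto
    then show ?thesis
      using greater assms(3) by (simp add: indicator_def)
  qed (use assms(3) in simp)
  then have "step_fun c n x t = (\<Sum>k'=1..n. c k' * (if k' = k then 1 else 0))"
    unfolding step_fun_def by (intro sum.cong) auto
  then show ?thesis
    using assms(2) by (simp add: if_distrib cong: if_cong)
qed

lemma step_fun_outside:
  assumes "\<And>k. k \<in> {1..n} \<Longrightarrow> t \<notin> {x (k - 1)<..x k}"
  shows "step_fun c n x t = 0"
  unfolding step_fun_def by (rule sum.neutral) (use assms in auto)

text \<open>
  The alternative does not depend on the coefficients, so statements that compare step
  functions with different coefficients on the same partition reduce to a single cell.
\<close>

lemma step_fun_cases:
  assumes "is_partition n x"
  obtains (outside) "\<And>c. step_fun c n x t = 0"
  | (cell) k where "k \<in> {1..n}" "x (k - 1) < t" "t \<le> x k" "\<And>c. step_fun c n x t = c k"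
proof (cases "\<exists>k\<in>{1..n}. t \<in> {x (k - 1)<..x k}")
  case True
  then obtain k where "k \<in> {1..n}" "t \<in> {x (k - 1)<..x k}" by blast
  then show ?thesis
    using step_fun_eq_coeff[OF assms, of k t] by (intro cell[of k]) auto
next
  case False
  then show ?thesis
    by (intro outside step_fun_outside) blast
qed

lemma partition_covers:
  fixes x :: "nat \<Rightarrow> real"
  assumes "x 0 < t" "t \<le> x n"
  obtains k where "k \<in> {1..n}" "t \<in> {x (k - 1)<..x k}"
proof -
  define k where "k = (LEAST k. t \<le> x k)"
  have "t \<le> x k"
    unfolding k_def using assms(2) by (rule LeastI)
  moreover have "k \<le> n"
    unfolding k_def using assms(2) by (rule Least_le)
  moreover have "k \<noteq> 0"
    using \<open>t \<le> x k\<close> assms(1) by (cases "k = 0") auto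
  moreover have "x (k - 1) < t"
    using not_less_Least[of "k - 1" "\<lambda>k. t \<le> x k"] \<open>k \<noteq> 0\<close> by (simp add: k_def[symmetric])
  ultimately show ?thesis
    by (intro that[of k]) auto
qed

lemma integrable_step_fun: "integrable lborel (step_fun c n x)"
  unfolding step_fun_def by (rule Bochner_Integration.integrable_sum)
    (auto simp: integrable_indicator_Ioc)

lemma integral_step_fun:
  assumes "is_partition n x"
  shows "(LINT t|lborel. step_fun c n x t) = (\<Sum>k=1..n. c k * (x k - x (k - 1)))"
proof -
  have "(LINT t|lborel. step_fun c n x t)
      = (\<Sum>k=1..n. LINT t|lborel. c k * indicator {x (k - 1)<..x k} t)"
    unfolding step_fun_def by (rule Bochner_Integration.integral_sum) (auto simp: integrable_indicator_Ioc)
  also have "\<dots> = (\<Sum>k=1..n. c k * (x k - x (k - 1)))"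
    using assms by (intro sum.cong) (auto simp: is_partition_def less_imp_le)
  finally show ?thesis .
qed

lemma cell_width_le_mesh:
  "k \<in> {1..n} \<Longrightarrow> x k - x (k - 1) \<le> mesh n x"
  unfolding mesh_def by (intro Max_ge) auto

section \<open>The discretized entropy as an integral\<close>

definition renyi_step :: "real \<Rightarrow> (real \<Rightarrow> real) \<Rightarrow> nat \<Rightarrow> (nat \<Rightarrow> real) \<Rightarrow> real \<Rightarrow> real" where
  "renyi_step \<alpha> p n x = step_fun (\<lambda>k. cell_average p (x (k - 1)) (x k) powr \<alpha>) n x"

lemma renyi_step_nonneg: "0 \<le> renyi_step \<alpha> p n x t"
  unfolding renyi_step_def step_fun_def by (intro sum_nonneg) auto

lemma discretized_renyi_entropy_eq_integral:
  assumes "is_partition n x"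
  shows "discretized_renyi_entropy \<alpha> p n x = 1 / (1 - \<alpha>) * ln (LINT t|lborel. renyi_step \<alpha> p n x t)"
proof -
  have "(distr_fun p (x k) - distr_fun p (x (k - 1))) powr \<alpha> * (x k - x (k - 1)) powr (1 - \<alpha>)
      = cell_average p (x (k - 1)) (x k) powr \<alpha> * (x k - x (k - 1))" if "k \<in> {1..n}" for k
  proof -
    have "0 < x k - x (k - 1)"
      using assms that by (auto simp: is_partition_def)
    then show ?thesis
      by (simp add: cell_average_def powr_divide powr_diff)
  qed
  then show ?thesis
    unfolding discretized_renyi_entropy_def renyi_step_def integral_step_fun[OF assms]
    by (intro arg_cong[where f = "\<lambda>S. 1 / (1 - \<alpha>) * ln S"] sum.cong refl)
qed

lemma integral_renyi_step_le:
  assumes p: "integrable lborel p" and p_nonneg: "\<And>s. 0 \<le> p s"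
    and pa: "integrable lborel (\<lambda>s. p s powr \<alpha>)" and "1 < \<alpha>" and part: "is_partition n x"
  shows "(LINT t|lborel. renyi_step \<alpha> p n x t) \<le> (LINT t|lborel. p t powr \<alpha>)"
proof -
  have cell_int: "integrable lborel (\<lambda>t. indicator {x (k - 1)<..x k} t * p t powr \<alpha>)" for k
    using integrable_mult_indicator[OF _ pa, of "{x (k - 1)<..x k}"] by auto
  have "(LINT t|lborel. renyi_step \<alpha> p n x t)
      \<le> (\<Sum>k=1..n. LINT t:{x (k - 1)<..x k}|lborel. p t powr \<alpha>)"
    unfolding renyi_step_def integral_step_fun[OF part]
    using part by (intro sum_mono cell_average_powr_le p p_nonneg pa \<open>1 < \<alpha>\<close>)
      (auto simp: is_partition_def)
  also have "\<dots> = (LINT t|lborel. (\<Sum>k=1..n. indicator {x (k - 1)<..x k} t * p t powr \<alpha>))"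
    unfolding set_lebesgue_integral_def real_scaleR_def
    by (rule Bochner_Integration.integral_sum[symmetric]) (rule cell_int)
  also have "\<dots> \<le> (LINT t|lborel. p t powr \<alpha>)"
  proof (rule integral_mono)
    fix t
    have "(\<Sum>k=1..n. indicator {x (k - 1)<..x k} t * p t powr \<alpha>) = step_fun (\<lambda>_. p t powr \<alpha>) n x t"
      unfolding step_fun_def by (simp add: mult.commute)
    also have "\<dots> \<le> p t powr \<alpha>"
      using part by (cases rule: step_fun_cases[where t = t]) auto
    finally show "(\<Sum>k=1..n. indicator {x (k - 1)<..x k} t * p t powr \<alpha>) \<le> p t powr \<alpha>" .
  qed (intro Bochner_Integration.integrable_sum cell_int pa)+
  finally show ?thesis .
qed

text \<open>
  A fixed point \<open>t\<close> eventually lies in a cell of the partition, because the end points run off to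
  infinity, and that cell shrinks to \<open>t\<close>.  The average of \<open>p\<close> over it lies between the bounds that
  continuity of \<open>p\<close> at \<open>t\<close> puts on the values of \<open>p\<close>.
\<close>

lemma renyi_step_tendsto:
  fixes x :: "nat \<Rightarrow> nat \<Rightarrow> real"
  assumes p: "integrable lborel p" and p_nonneg: "\<And>s. 0 \<le> p s"
    and cont: "continuous_on UNIV p" and "0 < \<alpha>"
    and part: "\<And>N. 1 \<le> N \<Longrightarrow> is_partition (K N) (x N)"
    and left: "filterlim (\<lambda>N. x N 0) at_bot sequentially"
    and right: "filterlim (\<lambda>N. x N (K N)) at_top sequentially"
    and mesh: "(\<lambda>N. mesh (K N) (x N)) \<longlonglongrightarrow> 0"
  shows "(\<lambda>N. renyi_step \<alpha> p (K N) (x N) t) \<longlonglongrightarrow> p t powr \<alpha>"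
proof -
  define avg where
    "avg N = step_fun (\<lambda>k. cell_average p (x N (k - 1)) (x N k)) (K N) (x N) t" for N
  have avg: "avg \<longlonglongrightarrow> p t"
  proof (rule LIMSEQ_I)
    fix r :: real assume "0 < r"
    have "isCont p t"
      using cont by (simp add: continuous_on_eq_continuous_at)
    then obtain d where "0 < d" and d: "\<And>s. \<bar>s - t\<bar> < d \<Longrightarrow> \<bar>p s - p t\<bar> < r / 2"
      using \<open>0 < r\<close> unfolding continuous_at_eps_delta dist_real_def
      by (metis half_gt_zero)
    have "eventually (\<lambda>N. mesh (K N) (x N) < d) sequentially"
      using order_tendstoD(2)[OF mesh \<open>0 < d\<close>] .
    moreover have "eventually (\<lambda>N. x N 0 < t) sequentially"
      using left by (simp add: filterlim_at_bot_dense)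
    moreover have "eventually (\<lambda>N. t \<le> x N (K N)) sequentially"
      using right by (simp add: filterlim_at_top)
    ultimately have "eventually (\<lambda>N. norm (avg N - p t) < r) sequentially"
      using eventually_ge_at_top[of 1]
    proof eventually_elim
      case (elim N)
      obtain k where k: "k \<in> {1..K N}" "t \<in> {x N (k - 1)<..x N k}"
        using partition_covers elim by blast
      have "x N k - x N (k - 1) < d"
        using cell_width_le_mesh[OF k(1), of "x N"] elim by simp
      then have "p t - r / 2 \<le> p s \<and> p s \<le> p t + r / 2"
        if "x N (k - 1) < s" "s \<le> x N k" for s
      proof -
        have "\<bar>s - t\<bar> < d"
          using that k(2) \<open>x N k - x N (k - 1) < d\<close> unfolding greaterThanAtMost_iff by linarith
        then show ?thesis
          using d[of s] by linarith
      qed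
      then have "p t - r / 2 \<le> cell_average p (x N (k - 1)) (x N k)"
        "cell_average p (x N (k - 1)) (x N k) \<le> p t + r / 2"
        using k(2) by (intro cell_average_bounds[OF p]; force)+
      then show ?case
        using step_fun_eq_coeff[OF part[OF elim(4)] k] \<open>0 < r\<close> by (simp add: avg_def)
    qed
    then show "\<exists>no. \<forall>n\<ge>no. norm (avg n - p t) < r"
      by (simp add: eventually_sequentially)
  qed
  \<comment> \<open>Off the cells this reads \<open>0 powr \<alpha> = 0\<close>.\<close>
  have "eventually (\<lambda>N. avg N powr \<alpha> = renyi_step \<alpha> p (K N) (x N) t) sequentially"
    using eventually_ge_at_top[of 1]
  proof eventually_elim
    case (elim N)
    show ?case
      using part[OF elim] \<open>0 < \<alpha>\<close> unfolding avg_def renyi_step_def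
      by (cases rule: step_fun_cases[where t = t]) simp_all
  qed
  moreover have "(\<lambda>N. avg N powr \<alpha>) \<longlonglongrightarrow> p t powr \<alpha>"
  proof (rule tendsto_powr'[OF avg tendsto_const])
    have "0 \<le> avg N" if "1 \<le> N" for N
      using part[OF that] unfolding avg_def
      by (cases rule: step_fun_cases[where t = t])
        (use cell_average_nonneg[OF p _ p_nonneg] in auto)
    then have "eventually (\<lambda>N. 0 \<le> avg N) sequentially"
      using eventually_sequentially by blast
    then show "p t \<noteq> 0 \<or> 0 < \<alpha> \<and> eventually (\<lambda>N. 0 \<le> avg N) sequentially"
      using \<open>0 < \<alpha>\<close> by simp
  qed
  ultimately show ?thesis
    by (rule Lim_transform_eventually[rotated])
qed

text \<open>
  The logarithm is continuous only away from \<open>0\<close>, so the limit of its arguments has to be nonzero.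
\<close>

lemma integral_powr_density_pos:
  assumes "prob_density p" "integrable lborel (\<lambda>x. p x powr \<alpha>)"
  shows "0 < (LINT x|lborel. p x powr \<alpha>)"
proof (rule ccontr)
  assume "\<not> ?thesis"
  then have "(LINT x|lborel. p x powr \<alpha>) = 0"
    by (simp add: integral_nonneg_AE order_antisym not_less)
  then have "AE x in lborel. p x powr \<alpha> = 0"
    using assms(2) by (subst (asm) integral_nonneg_eq_0_iff_AE) auto
  then have "AE x in lborel. p x = 0"
    by (rule eventually_mono) simp
  then have "(LINT x|lborel. p x) = 0"
    by (rule integral_eq_zero_AE)
  then show False
    using assms(1) by (simp add: prob_density_def)
qed

lemma discretized_renyi_entropy_tendsto:
  fixes x :: "nat \<Rightarrow> nat \<Rightarrow> real"
  assumes "prob_density p" "integrable lborel (\<lambda>x. p x powr \<alpha>)" "\<alpha> \<noteq> 1"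
    and part: "\<And>N. 1 \<le> N \<Longrightarrow> is_partition (K N) (x N)"
    and lim: "(\<lambda>N. LINT t|lborel. renyi_step \<alpha> p (K N) (x N) t) \<longlonglongrightarrow> (LINT t|lborel. p t powr \<alpha>)"
  shows "(\<lambda>N. discretized_renyi_entropy \<alpha> p (K N) (x N)) \<longlonglongrightarrow> renyi_entropy \<alpha> p"
proof -
  have "(\<lambda>N. 1 / (1 - \<alpha>) * ln (LINT t|lborel. renyi_step \<alpha> p (K N) (x N) t))
      \<longlonglongrightarrow> renyi_entropy \<alpha> p"
    unfolding renyi_entropy_def using integral_powr_density_pos[OF assms(1,2)]
    by (intro tendsto_intros lim) auto
  moreover have "eventually (\<lambda>N. 1 / (1 - \<alpha>) * ln (LINT t|lborel. renyi_step \<alpha> p (K N) (x N) t)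
      = discretized_renyi_entropy \<alpha> p (K N) (x N)) sequentially"
    using eventually_ge_at_top[of 1]
    by eventually_elim (simp add: discretized_renyi_entropy_eq_integral part)
  ultimately show ?thesis
    by (rule Lim_transform_eventually)
qed

section \<open>Index above one\<close>

text \<open>
  The step functions themselves have no evident integrable bound, but their minimum with the
  pointwise limit does.  This gives the lower half of a squeeze, and Jensen's inequality the upper
  half.
\<close>

lemma integral_renyi_step_tendsto_above_one:
  fixes x :: "nat \<Rightarrow> nat \<Rightarrow> real"
  assumes p: "integrable lborel p" and p_nonneg: "\<And>s. 0 \<le> p s"
    and pa: "integrable lborel (\<lambda>s. p s powr \<alpha>)" and "1 < \<alpha>"
    and part: "\<And>N. 1 \<le> N \<Longrightarrow> is_partition (K N) (x N)"
    and pointwise: "\<And>t. (\<lambda>N. renyi_step \<alpha> p (K N) (x N) t) \<longlonglongrightarrow> p t powr \<alpha>"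
  shows "(\<lambda>N. LINT t|lborel. renyi_step \<alpha> p (K N) (x N) t) \<longlonglongrightarrow> (LINT t|lborel. p t powr \<alpha>)"
proof -
  define low where "low N t = min (renyi_step \<alpha> p (K N) (x N) t) (p t powr \<alpha>)" for N t
  have step_int: "integrable lborel (renyi_step \<alpha> p (K N) (x N))" for N
    unfolding renyi_step_def by (rule integrable_step_fun)
  have low_int: "integrable lborel (low N)" for N
    unfolding low_def using step_int pa by (rule integrable_min)
  have "(\<lambda>N. integral\<^sup>L lborel (low N)) \<longlonglongrightarrow> (LINT t|lborel. p t powr \<alpha>)"
  proof (rule integral_dominated_convergence[where w = "\<lambda>t. p t powr \<alpha>"])
    have "(\<lambda>N. low N t) \<longlonglongrightarrow> p t powr \<alpha>" for t
      unfolding low_def using tendsto_min[OF pointwise[of t] tendsto_const[of "p t powr \<alpha>"]] by simp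
    then show "AE t in lborel. (\<lambda>N. low N t) \<longlonglongrightarrow> p t powr \<alpha>"
      by simp
    show "AE t in lborel. norm (low N t) \<le> p t powr \<alpha>" for N
      using renyi_step_nonneg[of \<alpha> p "K N" "x N"] by (auto simp: low_def min_def)
  qed (use pa low_int in auto)
  moreover have "integral\<^sup>L lborel (low N) \<le> (LINT t|lborel. renyi_step \<alpha> p (K N) (x N) t)" for N
    using low_int step_int by (rule integral_mono) (simp add: low_def)
  then have "eventually (\<lambda>N. integral\<^sup>L lborel (low N)
      \<le> (LINT t|lborel. renyi_step \<alpha> p (K N) (x N) t)) sequentially"
    by simp
  moreover have "eventually (\<lambda>N. (LINT t|lborel. renyi_step \<alpha> p (K N) (x N) t)
      \<le> (LINT t|lborel. p t powr \<alpha>)) sequentially"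
    using eventually_ge_at_top[of 1]
    by eventually_elim (intro integral_renyi_step_le p p_nonneg pa \<open>1 < \<alpha>\<close> part)
  ultimately show ?thesis
    by (rule tendsto_sandwich[OF _ _ _ tendsto_const, rotated 2])
qed

section \<open>Monotone tails\<close>

text \<open>
  Only the tails need care.  There an average over a cell shorter than \<open>1\<close> is bounded by a value of
  \<open>p\<close> one unit closer to the origin, and translates of \<open>p powr \<alpha>\<close> are integrable.
\<close>

lemma integral_renyi_step_tendsto_monotone_tails:
  fixes x :: "nat \<Rightarrow> nat \<Rightarrow> real"
  assumes p: "integrable lborel p" and p_nonneg: "\<And>s. 0 \<le> p s"
    and pa: "integrable lborel (\<lambda>s. p s powr \<alpha>)" and "0 < \<alpha>"
    and cont: "continuous_on UNIV p"
    and tails: "mono_on {..- z} p" "antimono_on {z..} p" and "0 < z"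
    and part: "\<And>N. 1 \<le> N \<Longrightarrow> is_partition (K N) (x N)"
    and mesh: "(\<lambda>N. mesh (K N) (x N)) \<longlonglongrightarrow> 0"
    and pointwise: "\<And>t. (\<lambda>N. renyi_step \<alpha> p (K N) (x N) t) \<longlonglongrightarrow> p t powr \<alpha>"
  shows "(\<lambda>N. LINT t|lborel. renyi_step \<alpha> p (K N) (x N) t) \<longlonglongrightarrow> (LINT t|lborel. p t powr \<alpha>)"
proof -
  have "compact (p ` {-z-2..z+2})"
    using cont by (intro compact_continuous_image continuous_on_subset[OF cont]) auto
  then have "bounded (p ` {-z-2..z+2})"
    by (rule compact_imp_bounded)
  then obtain M where M: "\<And>s. s \<in> {-z-2..z+2} \<Longrightarrow> p s \<le> M"
    unfolding bounded_iff by (force simp: abs_le_iff)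
  \<comment> \<open>For \<open>\<bar>t\<bar> \<le> z + 1\<close> a cell around \<open>t\<close> stays inside \<open>[-z - 2, z + 2]\<close>; for \<open>\<bar>t\<bar> > z + 1\<close> it stays
     inside a tail, together with the point one unit closer to the origin.\<close>
  define w where
    "w t = indicator {-z-2..z+2} t * M powr \<alpha> + p (t - 1) powr \<alpha> + p (t + 1) powr \<alpha>" for t
  have w_int: "integrable lborel w"
    unfolding w_def
    using lborel_integrable_real_affine[OF pa, of 1 "-1"]
      lborel_integrable_real_affine[OF pa, of 1 1] \<open>0 < z\<close>
    by (intro Bochner_Integration.integrable_add) (auto simp: add.commute)
  obtain N0 where "1 \<le> N0" and N0: "\<And>N. N0 \<le> N \<Longrightarrow> mesh (K N) (x N) < 1"
  proof -
    have "eventually (\<lambda>N. 1 \<le> N \<and> mesh (K N) (x N) < 1) sequentially"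
      using order_tendstoD(2)[OF mesh zero_less_one] eventually_ge_at_top[of 1]
      by eventually_elim auto
    then show ?thesis
      using that unfolding eventually_sequentially by (metis order_refl)
  qed
  have dom: "norm (renyi_step \<alpha> p (K N) (x N) t) \<le> w t" if "N0 \<le> N" for N t
  proof -
    have "is_partition (K N) (x N)"
      using part \<open>1 \<le> N0\<close> that by simp
    then have "renyi_step \<alpha> p (K N) (x N) t \<le> w t"
    proof (cases rule: step_fun_cases[where t = t])
      case outside
      then show ?thesis
        by (simp add: renyi_step_def w_def)
    next
      case (cell k)
      let ?a = "x N (k - 1)" and ?b = "x N k"
      have "?b - ?a < 1"
        using cell_width_le_mesh[OF cell(1), of "x N"] N0[OF that] by simp
      then have near: "t - 1 < s \<and> s < t + 1" if "?a < s" "s \<le> ?b" for s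
        using that cell(2,3) by auto
      have avg_le: "cell_average p ?a ?b powr \<alpha> \<le> U powr \<alpha>"
        if "\<And>s. t - 1 < s \<Longrightarrow> s < t + 1 \<Longrightarrow> p s \<le> U" for U
      proof -
        have "cell_average p ?a ?b \<le> U"
          using cell(2,3) near that p_nonneg
          by (intro cell_average_bounds(2)[OF p, where L = 0]) auto
        then show ?thesis
          using cell_average_nonneg[OF p _ p_nonneg] cell(2,3) \<open>0 < \<alpha>\<close>
          by (intro powr_mono2) auto
      qed
      consider "t < - z - 1" | "\<bar>t\<bar> \<le> z + 1" | "z + 1 < t" by linarith
      then have "cell_average p ?a ?b powr \<alpha> \<le> w t"
      proof cases
        case 1
        have "cell_average p ?a ?b powr \<alpha> \<le> p (t + 1) powr \<alpha>"
          using 1 by (intro avg_le mono_onD[OF tails(1)]) auto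
        then show ?thesis by (simp add: w_def add_increasing)
      next
        case 2
        have "cell_average p ?a ?b powr \<alpha> \<le> M powr \<alpha>"
          using 2 by (intro avg_le M) auto
        moreover have "t \<in> {-z-2..z+2}" using 2 by auto
        ultimately show ?thesis by (simp add: w_def add_increasing2)
      next
        case 3
        have "cell_average p ?a ?b powr \<alpha> \<le> p (t - 1) powr \<alpha>"
          using 3 by (intro avg_le monotone_onD[OF tails(2)]) auto
        then show ?thesis by (simp add: w_def add_increasing add_increasing2)
      qed
      then show ?thesis
        by (simp add: renyi_step_def cell(4))
    qed
    then show ?thesis
      using renyi_step_nonneg[of \<alpha> p "K N" "x N" t] by simp
  qed
  have step_int: "integrable lborel (renyi_step \<alpha> p (K N) (x N))" for N
    unfolding renyi_step_def by (rule integrable_step_fun)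
  have "(\<lambda>N. LINT t|lborel. renyi_step \<alpha> p (K (N + N0)) (x (N + N0)) t)
      \<longlonglongrightarrow> (LINT t|lborel. p t powr \<alpha>)"
  proof (rule integral_dominated_convergence[where w = w])
    show "AE t in lborel. (\<lambda>N. renyi_step \<alpha> p (K (N + N0)) (x (N + N0)) t) \<longlonglongrightarrow> p t powr \<alpha>"
      using LIMSEQ_ignore_initial_segment[OF pointwise, where k = N0] by auto
  qed (use pa step_int w_int dom in auto)
  then show ?thesis
    by (rule LIMSEQ_offset)
qed

section \<open>Uniform partitions\<close>

lemma mesh_uniform_points:
  assumes "1 \<le> N"
  shows "mesh (2 * N ^ 2) (uniform_points N) = 1 / real N"
proof -
  have "(\<lambda>k. uniform_points N k - uniform_points N (k - 1)) ` {1..2 * N ^ 2}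
      = (\<lambda>_. 1 / real N) ` {1..2 * N ^ 2}"
    by (rule image_cong)
      (auto simp: uniform_points_def of_nat_diff diff_divide_distrib add_divide_distrib)
  also have "\<dots> = {1 / real N}"
    using assms by (auto simp: image_constant_conv)
  finally show ?thesis
    by (simp add: mesh_def)
qed

lemma uniform_points_limits:
  shows "filterlim (\<lambda>N. uniform_points N 0) at_bot sequentially"
    and "filterlim (\<lambda>N. uniform_points N (2 * N ^ 2)) at_top sequentially"
    and "(\<lambda>N. mesh (2 * N ^ 2) (uniform_points N)) \<longlonglongrightarrow> 0"
proof -
  have "uniform_points N 0 = - real N" "uniform_points N (2 * N ^ 2) = real N" for N
    by (auto simp: uniform_points_def power2_eq_square)
  then show "filterlim (\<lambda>N. uniform_points N 0) at_bot sequentially"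
    and "filterlim (\<lambda>N. uniform_points N (2 * N ^ 2)) at_top sequentially"
    by (simp_all add: filterlim_uminus_at_bot filterlim_real_sequentially)
  have "eventually (\<lambda>N. 1 / real N = mesh (2 * N ^ 2) (uniform_points N)) sequentially"
    using eventually_ge_at_top[of 1] by eventually_elim (simp only: mesh_uniform_points)
  then show "(\<lambda>N. mesh (2 * N ^ 2) (uniform_points N)) \<longlonglongrightarrow> 0"
    by (rule Lim_transform_eventually[OF lim_1_over_n])
qed

theorem theorem3:
  fixes p :: "real \<Rightarrow> real" and \<alpha> :: real
  assumes "prob_density p"
    and "0 < \<alpha>" and "\<alpha> \<noteq> 1"
    and "integrable lborel (\<lambda>x. p x powr \<alpha>)"
  shows "(1 < \<alpha> \<and> continuous_on UNIV p \<longrightarrow>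
           (\<forall>(K :: nat \<Rightarrow> nat) (x :: nat \<Rightarrow> nat \<Rightarrow> real).
              (\<forall>N\<ge>1. is_partition (K N) (x N)) \<and>
              filterlim (\<lambda>N. x N 0) at_bot sequentially \<and>
              filterlim (\<lambda>N. x N (K N)) at_top sequentially \<and>
              (\<lambda>N. mesh (K N) (x N)) \<longlonglongrightarrow> 0 \<longrightarrow>
              (\<lambda>N. discretized_renyi_entropy \<alpha> p (K N) (x N)) \<longlonglongrightarrow> renyi_entropy \<alpha> p))
       \<and> (\<alpha> < 1 \<and> continuous_on UNIV p \<and>
          (\<exists>z>0. mono_on {..- z} p \<and> antimono_on {z..} p) \<longrightarrow>
            (\<lambda>N. discretized_renyi_entropy \<alpha> p (2 * N ^ 2) (uniform_points N))
              \<longlonglongrightarrow> renyi_entropy \<alpha> p)"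
proof (intro conjI impI allI)
  have p: "integrable lborel p" and p_nonneg: "\<And>s. 0 \<le> p s"
    using assms(1) by (auto simp: prob_density_def)
  note pa = assms(4)
  {
    fix K :: "nat \<Rightarrow> nat" and x :: "nat \<Rightarrow> nat \<Rightarrow> real"
    assume index: "1 < \<alpha> \<and> continuous_on UNIV p"
      and partitions: "(\<forall>N\<ge>1. is_partition (K N) (x N)) \<and>
        filterlim (\<lambda>N. x N 0) at_bot sequentially \<and>
        filterlim (\<lambda>N. x N (K N)) at_top sequentially \<and>
        (\<lambda>N. mesh (K N) (x N)) \<longlonglongrightarrow> 0"
    then have part: "\<And>N. 1 \<le> N \<Longrightarrow> is_partition (K N) (x N)"
      by blast
    have "(\<lambda>N. renyi_step \<alpha> p (K N) (x N) t) \<longlonglongrightarrow> p t powr \<alpha>" for t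
      using index partitions by (intro renyi_step_tendsto p p_nonneg assms(2) part) auto
    then show "(\<lambda>N. discretized_renyi_entropy \<alpha> p (K N) (x N)) \<longlonglongrightarrow> renyi_entropy \<alpha> p"
      using index by (intro discretized_renyi_entropy_tendsto assms part
          integral_renyi_step_tendsto_above_one p p_nonneg) auto
  next
    assume tails: "\<alpha> < 1 \<and> continuous_on UNIV p \<and>
      (\<exists>z>0. mono_on {..- z} p \<and> antimono_on {z..} p)"
    then obtain z where z: "0 < z" "mono_on {..- z} p" "antimono_on {z..} p"
      by blast
    note part = is_partition_uniform_points
    have "(\<lambda>N. renyi_step \<alpha> p (2 * N ^ 2) (uniform_points N) t) \<longlonglongrightarrow> p t powr \<alpha>" for t
      using tails by (intro renyi_step_tendsto p p_nonneg assms(2) part uniform_points_limits) auto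
    then show "(\<lambda>N. discretized_renyi_entropy \<alpha> p (2 * N ^ 2) (uniform_points N))
        \<longlonglongrightarrow> renyi_entropy \<alpha> p"
      using tails z
      by (intro discretized_renyi_entropy_tendsto assms part uniform_points_limits
          integral_renyi_step_tendsto_monotone_tails[where z = z] p p_nonneg) auto
  }
qed

end
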